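(* Let $Q=\{x\in\mathbb{R}^n_+\mid Ax\le b\}$ be a packing polyhedron with $A_{ij}\le b_i$ for all $i\in[m]$, $j\in[n]$. Then, for every integer $k\ge1$ (and every objective $c\in\mathbb{R}^n_+$, $c\neq 0$, with $z^{LP}<\infty$), $$\operatorname{rank}_{\mathcal{A}_k}(Q)\ \ge\ \left\lceil\frac{\log_2\left(\frac{z^{LP}}{z^I}\right)}{\log_2(k+1)}\right\rceil .$$ Moreover, this bound is tight for $k=1$, that is, there is a packing polyhedron $Q$ with $\operatorname{rank}_{\mathcal{A}_1}(Q)\le O\left(\log_2\left(\frac{z^{LP}}{z^I}\right)\right)$.
   Context: $[n]=\{1,\dots,n\}$. A packing polyhedron is $\{x\in\mathbb{R}^n_+\mid Ax\le b\}$ with $A\in\mathbb{Q}^{m\times n}$, $b\in\mathbb{Q}^m$ entrywise non-negative. A packing set is a set $\{x\in\mathbb{R}^n_+\mid A^ix\le b_i\ \forall i\in I\}$ with $I$ an arbitrary index set and each $(A^i,b_i)\in\mathbb{R}^{1\times n}_+\times\mathbb{R}_+$. $Q^I=\operatorname{conv}(Q\cap\mathbb{Z}^n)$ is the integer hull. For a packing set $Q$, the $k$-aggregation closure $\mathcal{A}_k(Q)$ is the intersection of all sets $\operatorname{conv}(\{x\in\mathbb{Z}^n_+\mid D^jx\le f_j\ \forall j\in[k]\})$ over all choices of $k$ inequalities $D^jx\le f_j$ with non-negative coefficients that are valid for $Q$. $\mathcal{A}_k(Q)$ is again a packing set. The rank $\operatorname{rank}_{\mathcal{A}_k}(Q)$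 is the minimum number of iterated applications of $\mathcal{A}_k$, starting from $Q$, needed to obtain $Q^I$. For an objective $c\in\mathbb{R}^n_+$: $z^{LP}=\max\{c^\top x\mid x\in Q\}$ and $z^I=\max\{c^\top x\mid x\in Q^I\}$. *)

theory Defs
  imports
    "HOL-Analysis.Analysis"
    "HOL-Analysis.Finite_Function_Topology"
    "HOL-Library.Landau_Symbols"
    "HOL-Library.Extended_Nat"
begin

text \<open>
  The dimension \<open>n\<close> has to vary inside a single formula, so the space of real \<open>n\<close>-vectors is
  represented by the finitely supported functions \<open>nat \<Rightarrow>\<^sub>0 real\<close> whose support lies in
  \<open>{..<n}\<close> (coordinates are counted from 0). This type is a real vector space in the library,
  so the convex hull is the library one.
\<close>

type_synonym rvec = "nat \<Rightarrow>\<^sub>0 real"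

definition dot :: "nat \<Rightarrow> rvec \<Rightarrow> rvec \<Rightarrow> real" where
  "dot n u x = (\<Sum>j<n. Poly_Mapping.lookup u j * Poly_Mapping.lookup x j)"

definition orthant :: "nat \<Rightarrow> rvec set" where
  "orthant n = {x. Poly_Mapping.keys x \<subseteq> {..<n} \<and> (\<forall>j<n. 0 \<le> Poly_Mapping.lookup x j)}"

definition lattice_points :: "nat \<Rightarrow> rvec set" where
  "lattice_points n =
     {x. Poly_Mapping.keys x \<subseteq> {..<n} \<and> (\<forall>j<n. Poly_Mapping.lookup x j \<in> \<int>)}"

definition packing_data :: "nat \<Rightarrow> nat \<Rightarrow> (nat \<Rightarrow> nat \<Rightarrow> real) \<Rightarrow> (nat \<Rightarrow> real) \<Rightarrow> bool" where
  "packing_data n m A b \<longleftrightarrow>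
     (\<forall>i<m. b i \<in> \<rat> \<and> 0 \<le> b i \<and> (\<forall>j<n. A i j \<in> \<rat> \<and> 0 \<le> A i j))"

text \<open>Only the entries \<open>A i j\<close>, \<open>b i\<close> with \<open>i < m\<close>, \<open>j < n\<close> matter.\<close>

definition packing_polyhedron ::
  "nat \<Rightarrow> nat \<Rightarrow> (nat \<Rightarrow> nat \<Rightarrow> real) \<Rightarrow> (nat \<Rightarrow> real) \<Rightarrow> rvec set" where
  "packing_polyhedron n m A b =
     {x \<in> orthant n. \<forall>i<m. (\<Sum>j<n. A i j * Poly_Mapping.lookup x j) \<le> b i}"

definition integer_hull :: "nat \<Rightarrow> rvec set \<Rightarrow> rvec set" where
  "integer_hull n Q = convex hull (Q \<inter> lattice_points n)"

text \<open>
  The coefficients \<open>D j\<close> and right-hand sides \<open>f j\<close> are real and need not be distinct. For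
  \<open>Q\<close> containing the origin, validity already forces \<open>f j \<ge> 0\<close>. The intersected family is never
  empty, since the trivial inequality \<open>0 \<le> 0\<close> is always valid.
\<close>

definition aggregation_closure :: "nat \<Rightarrow> nat \<Rightarrow> rvec set \<Rightarrow> rvec set" where
  "aggregation_closure n k Q =
     \<Inter> {convex hull {x \<in> orthant n \<inter> lattice_points n. \<forall>j<k. dot n (D j) x \<le> f j} | D f.
         \<forall>j<k. D j \<in> orthant n \<and> (\<forall>x\<in>Q. dot n (D j) x \<le> f j)}"

text \<open>The rank is \<open>\<infinity>\<close> if no finite number of iterations reaches the integer hull.\<close>

definition aggregation_rank :: "nat \<Rightarrow> nat \<Rightarrow> rvec set \<Rightarrow> enat" where
  "aggregation_rank n k Q =
     Inf {enat t | t. (aggregation_closure n k ^^ t) Q = integer_hull n Q}"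

text \<open>
  The supremum agrees with the maximum whenever the latter exists; it is a meaningful value only
  for nonempty sets on which the objective is bounded above.
\<close>

definition opt_value :: "nat \<Rightarrow> rvec \<Rightarrow> rvec set \<Rightarrow> real" where
  "opt_value n c S = (SUP x\<in>S. dot n c x)"

definition integrality_ratio :: "nat \<Rightarrow> rvec \<Rightarrow> rvec set \<Rightarrow> real" where
  "integrality_ratio n c Q = opt_value n c Q / opt_value n c (integer_hull n Q)"

definition admissible_instance ::
  "nat \<Rightarrow> nat \<Rightarrow> (nat \<Rightarrow> nat \<Rightarrow> real) \<Rightarrow> (nat \<Rightarrow> real) \<Rightarrow> rvec \<Rightarrow> bool" where
  "admissible_instance n m A b c \<longleftrightarrow>
     packing_data n m A b \<and> (\<forall>i<m. \<forall>j<n. A i j \<le> b i) \<and>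
     c \<in> orthant n \<and> c \<noteq> 0 \<and> bdd_above (dot n c ` packing_polyhedron n m A b)"

end

theory Submission
  imports Defs "HOL-Real_Asymp.Real_Asymp"
begin

text \<open>
  Lower bound. Moving a feasible point along the kernel of the \<open>k\<close> aggregated constraints, inside
  the box between the roundings of its fractional coordinates, writes it as a convex combination
  of feasible points with at most \<open>k\<close> fractional coordinates. Such a point is its floor plus a
  combination of at most \<open>k\<close> unit vectors, all of them feasible because \<open>A i j \<le> b i\<close>; after division
  by \<open>k + 1\<close> it lies in the integer hull. So one application of the closure shrinks the
  optimal value by a factor of at most \<open>k + 1\<close>.

  Tightness. For the edge relaxation of the stable sets of the complete graph on \<open>2 ^ t + 1\<close> nodes
  the integrality ratio is at least half the number of nodes. Suppose the clique
  inequalities of size \<open>s + 1\<close> are valid. Covering a set \<open>T\<close> of \<open>2 s + 1\<close> nodes by two such cliques that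
  share only \<open>p\<close> gives \<open>x(T) \<le> 2 - x p\<close>; averaging over \<open>p \<in> T\<close> gives a bound below 2 on \<open>x(T)\<close>,
  which rounds down to 1. So the size of the valid cliques almost doubles and \<open>t\<close> rounds suffice.
\<close>

section \<open>Finitely supported vectors\<close>

lemma lookup_scaleR [simp]:
  fixes x :: "'a \<Rightarrow>\<^sub>0 'b::real_vector"
  shows "Poly_Mapping.lookup (r *\<^sub>R x) i = r *\<^sub>R Poly_Mapping.lookup x i"
proof -
  have "finite {i. r *\<^sub>R Poly_Mapping.lookup x i \<noteq> 0}"
    by (rule finite_subset[of _ "Poly_Mapping.keys x"]) (auto simp: in_keys_iff)
  then show ?thesis
    by (simp add: scaleR_poly_mapping_def)
qed

definition vec_on :: "nat set \<Rightarrow> (nat \<Rightarrow> real) \<Rightarrow> rvec" where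
  "vec_on F g = (\<Sum>i\<in>F. Poly_Mapping.single i (g i))"

lemma lookup_vec_on:
  "finite F \<Longrightarrow> Poly_Mapping.lookup (vec_on F g) j = (if j \<in> F then g j else 0)"
  unfolding vec_on_def lookup_sum by (simp add: lookup_single when_def sum.delta')

lemma dot_add: "dot n u (x + y) = dot n u x + dot n u y"
  by (simp add: dot_def lookup_add algebra_simps sum.distrib)

lemma dot_scaleR: "dot n u (r *\<^sub>R x) = r * dot n u x"
  by (simp add: dot_def sum_distrib_left mult_ac)

lemma dot_zero [simp]: "dot n u 0 = 0"
  by (simp add: dot_def)

lemma dot_single:
  "j < n \<Longrightarrow> dot n u (Poly_Mapping.single j r) = Poly_Mapping.lookup u j * r"
  by (simp add: dot_def lookup_single when_def if_distrib[of "\<lambda>z. _ * z"] sum.delta cong: if_cong)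

lemma dot_vec_on_left:
  "F \<subseteq> {..<n} \<Longrightarrow> dot n (vec_on F g) x = (\<Sum>i\<in>F. g i * Poly_Mapping.lookup x i)"
  unfolding dot_def
  by (rule sum.mono_neutral_cong_right) (auto simp: lookup_vec_on finite_subset)

lemma dot_vec_on_right:
  "F \<subseteq> {..<n} \<Longrightarrow> dot n u (vec_on F g) = (\<Sum>i\<in>F. Poly_Mapping.lookup u i * g i)"
  unfolding dot_def
  by (rule sum.mono_neutral_cong_right) (auto simp: lookup_vec_on finite_subset)

lemma convex_dot_le: "convex {x. dot n u x \<le> f}"
proof (rule convexI)
  fix x y and s t :: real
  assume "x \<in> {x. dot n u x \<le> f}" "y \<in> {x. dot n u x \<le> f}"
    and st: "0 \<le> s" "0 \<le> t" "s + t = 1"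
  then have "s * dot n u x + t * dot n u y \<le> s * f + t * f"
    by (intro add_mono mult_left_mono) auto
  also have "\<dots> = f"
    using st by (simp flip: distrib_right)
  finally show "s *\<^sub>R x + t *\<^sub>R y \<in> {x. dot n u x \<le> f}"
    by (simp add: dot_add dot_scaleR)
qed

text \<open>Coordinates from \<open>n\<close> on vanish, so the sign condition may be imposed on
  every coordinate; later membership proofs then work coordinate by coordinate without tracking
  supports. The same holds for the lattice points below.\<close>

lemma orthant_iff:
  "x \<in> orthant n \<longleftrightarrow>
    (\<forall>j. 0 \<le> Poly_Mapping.lookup x j) \<and> (\<forall>j\<ge>n. Poly_Mapping.lookup x j = 0)"
  unfolding orthant_def subset_iff lessThan_iff in_keys_iff mem_Collect_eq
  by (metis linorder_not_less order_refl)

lemma lattice_points_iff: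
  "x \<in> lattice_points n \<longleftrightarrow>
    (\<forall>j. Poly_Mapping.lookup x j \<in> \<int>) \<and> (\<forall>j\<ge>n. Poly_Mapping.lookup x j = 0)"
  unfolding lattice_points_def subset_iff lessThan_iff in_keys_iff mem_Collect_eq
  by (metis linorder_not_less Ints_0)

lemma convex_orthant: "convex (orthant n)"
  by (rule convexI) (auto simp: orthant_iff lookup_add)

lemma zero_orthant: "0 \<in> orthant n"
  by (simp add: orthant_iff)

lemma zero_lattice_points: "0 \<in> lattice_points n"
  by (simp add: lattice_points_iff)

lemma unit_orthant: "j < n \<Longrightarrow> Poly_Mapping.single j 1 \<in> orthant n"
  by (auto simp: orthant_iff lookup_single when_def)

lemma unit_lattice_points: "j < n \<Longrightarrow> Poly_Mapping.single j 1 \<in> lattice_points n"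
  by (auto simp: lattice_points_iff lookup_single when_def)

section \<open>Subconvex combinations and homogeneous linear systems\<close>

lemma convex_subunit_sum:
  fixes C :: "'a::real_vector set"
  assumes "finite S" "convex C" "0 \<in> C" "sum a S \<le> 1"
    and a: "\<And>i. i \<in> S \<Longrightarrow> 0 \<le> a i" and y: "\<And>i. i \<in> S \<Longrightarrow> y i \<in> C"
  shows "(\<Sum>i\<in>S. a i *\<^sub>R y i) \<in> C"
proof (cases "sum a S = 0")
  case True
  then have "\<forall>i\<in>S. a i = 0"
    using assms(1) a by (simp add: sum_nonneg_eq_0_iff)
  then show ?thesis
    using \<open>0 \<in> C\<close> by simp
next
  case False
  define s where "s = sum a S"
  \<comment> \<open>The weights are normalised to total 1, and the missing weight
    \<open>1 - s\<close> is then put on the origin.\<close>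
  have s: "0 < s" "s \<le> 1"
    using False assms(4) sum_nonneg[of S a] a unfolding s_def by fastforce+
  have "(\<Sum>i\<in>S. (a i / s) *\<^sub>R y i) \<in> C"
    using assms s by (intro convex_sum) (auto simp flip: sum_divide_distrib simp: s_def)
  then have "s *\<^sub>R (\<Sum>i\<in>S. (a i / s) *\<^sub>R y i) + (1 - s) *\<^sub>R 0 \<in> C"
    using s \<open>convex C\<close> \<open>0 \<in> C\<close> by (intro convexD) auto
  also have "s *\<^sub>R (\<Sum>i\<in>S. (a i / s) *\<^sub>R y i) + (1 - s) *\<^sub>R 0 = (\<Sum>i\<in>S. a i *\<^sub>R y i)"
    using s by (simp add: scaleR_sum_right)
  finally show ?thesis .
qed

text \<open>Fewer equations than unknowns leave a nonzero solution. Gaussian elimination by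
  induction on the number of equations: the last equation either vanishes on \<open>F\<close> or
  eliminates one unknown.\<close>

lemma ex_kernel_vector:
  fixes a :: "nat \<Rightarrow> 'i \<Rightarrow> 'a::field"
  assumes "finite F" "k < card F"
  shows "\<exists>g. (\<exists>i\<in>F. g i \<noteq> 0) \<and> (\<forall>j<k. (\<Sum>i\<in>F. a j i * g i) = 0)"
  using assms
proof (induction k arbitrary: F a)
  case 0
  then obtain p where "p \<in> F"
    by (auto simp: card_gt_0_iff)
  then show ?case
    by (intro exI[of _ "\<lambda>_. 1"]) auto
next
  case (Suc k)
  show ?case
  proof (cases "\<forall>i\<in>F. a k i = 0")
    case True
    obtain g where "\<exists>i\<in>F. g i \<noteq> 0" "\<forall>j<k. (\<Sum>i\<in>F. a j i * g i) = 0"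
      using Suc.IH[of F a] Suc.prems by auto
    then show ?thesis
      using True by (intro exI[of _ g]) (auto simp: less_Suc_eq)
  next
    case False
    then obtain p where p: "p \<in> F" "a k p \<noteq> 0"
      by auto
    have card: "finite (F - {p})" "k < card (F - {p})"
      using Suc.prems p by auto
    \<comment> \<open>These are the first \<open>k\<close> equations after subtracting the multiple
      of equation \<open>k\<close> that cancels the unknown \<open>p\<close>.\<close>
    obtain g where g: "\<exists>i\<in>F - {p}. g i \<noteq> 0"
      "\<forall>j<k. (\<Sum>i\<in>F - {p}. (a j i - a j p * a k i / a k p) * g i) = 0"
      using Suc.IH[OF card, of "\<lambda>j i. a j i - a j p * a k i / a k p"] by blast
    \<comment> \<open>Back substitution: the value at \<open>p\<close> is the one that solves
      equation \<open>k\<close>.\<close>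
    define h where "h = g(p := - (\<Sum>i\<in>F - {p}. a k i * g i) / a k p)"
    have split: "(\<Sum>i\<in>F. a j i * h i) =
        (\<Sum>i\<in>F - {p}. a j i * g i) - a j p / a k p * (\<Sum>i\<in>F - {p}. a k i * g i)" for j
      using p Suc.prems by (subst sum.remove[of F p]) (auto simp: h_def)
    have zero: "(\<Sum>i\<in>F. a j i * h i) = 0" if "j < Suc k" for j
    proof (cases "j = k")
      case True
      then show ?thesis
        using p by (simp add: split)
    next
      case False
      have "(\<Sum>i\<in>F. a j i * h i) =
          (\<Sum>i\<in>F - {p}. (a j i - a j p * a k i / a k p) * g i)"
        unfolding split by (simp add: left_diff_distrib sum_subtractf sum_distrib_left mult.assoc)
      also have "\<dots> = 0"
        using g(2) False that by simp
      finally show ?thesis .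
    qed
    have "\<exists>i\<in>F. h i \<noteq> 0"
      using g(1) by (auto simp: h_def)
    then show ?thesis
      using zero by blast
  qed
qed

section \<open>Rounding against few constraints\<close>

definition frac_coords :: "rvec \<Rightarrow> nat set" where
  "frac_coords x = {j. Poly_Mapping.lookup x j \<notin> \<int>}"

lemma frac_coords_subset: "x \<in> orthant n \<Longrightarrow> frac_coords x \<subseteq> {..<n}"
  unfolding frac_coords_def orthant_iff
  by (metis (mono_tags, lifting) Ints_0 lessThan_iff linorder_not_less mem_Collect_eq subsetI)

lemma finite_frac_coords: "finite (frac_coords x)"
  by (rule finite_subset[of _ "Poly_Mapping.keys x"]) (auto simp: frac_coords_def in_keys_iff)

text \<open>Walk from \<open>x\<close> along \<open>d\<close> until some coordinate first becomes an
  integer. Only fractional coordinates move, so integral ones stay integral, and none drops below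
  its floor, which is nonnegative.\<close>

lemma ex_move_to_integer_coordinate:
  assumes x: "x \<in> orthant n" and d: "d \<noteq> 0" "Poly_Mapping.keys d \<subseteq> frac_coords x"
  shows "\<exists>t>0. x + t *\<^sub>R d \<in> orthant n \<and> frac_coords (x + t *\<^sub>R d) \<subset> frac_coords x"
proof -
  let ?x = "Poly_Mapping.lookup x" and ?d = "Poly_Mapping.lookup d"
  \<comment> \<open>The next integer that coordinate \<open>i\<close> meets in its direction of
    travel, and below it the time of that meeting. Since \<open>?x i\<close> is fractional, this
    time is positive.\<close>
  define target where
    "target = (\<lambda>i. real_of_int (if 0 < ?d i then \<lceil>?x i\<rceil> else \<lfloor>?x i\<rfloor>))"
  define time where "time = (\<lambda>i. (target i - ?x i) / ?d i)"
  define t where "t = Min (time ` Poly_Mapping.keys d)"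
  have ne: "time ` Poly_Mapping.keys d \<noteq> {}"
    using d by simp
  have pos: "0 < time i" if "i \<in> Poly_Mapping.keys d" for i
  proof -
    have i: "?x i \<notin> \<int>" "?d i \<noteq> 0"
      using that d by (auto simp: frac_coords_def in_keys_iff)
    have "?x i \<noteq> real_of_int \<lceil>?x i\<rceil>" "?x i \<noteq> real_of_int \<lfloor>?x i\<rfloor>"
      using i by (metis Ints_of_int)+
    then have "?x i < real_of_int \<lceil>?x i\<rceil>" "real_of_int \<lfloor>?x i\<rfloor> < ?x i"
      using le_of_int_ceiling[of "?x i"] of_int_floor_le[of "?x i"] by linarith+
    then show ?thesis
      using i by (auto simp: time_def target_def zero_less_divide_iff)
  qed
  have t: "0 < t" "\<And>i. i \<in> Poly_Mapping.keys d \<Longrightarrow> t \<le> time i"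
    using pos ne by (auto simp: t_def)
  have "t \<in> time ` Poly_Mapping.keys d"
    unfolding t_def using ne by (intro Min_in) auto
  then obtain p where p: "p \<in> Poly_Mapping.keys d" "t = time p"
    by auto
  have "?x p + t * ?d p = target p"
    using p by (simp add: time_def in_keys_iff)
  then have "p \<notin> frac_coords (x + t *\<^sub>R d)"
    by (auto simp: frac_coords_def lookup_add target_def)
  moreover have "p \<in> frac_coords x"
    using p d by auto
  moreover have "frac_coords (x + t *\<^sub>R d) \<subseteq> frac_coords x"
  proof
    fix i assume i: "i \<in> frac_coords (x + t *\<^sub>R d)"
    show "i \<in> frac_coords x"
    proof (cases "i \<in> Poly_Mapping.keys d")
      case False
      then show ?thesis
        using i by (simp add: frac_coords_def lookup_add in_keys_iff)
    qed (use d in blast)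
  qed
  moreover have "x + t *\<^sub>R d \<in> orthant n"
  proof -
    have "0 \<le> ?x i + t * ?d i" for i
    proof (cases "?d i < 0")
      case True
      then have "t \<le> (target i - ?x i) / ?d i"
        using t(2)[of i] by (simp add: in_keys_iff time_def)
      \<comment> \<open>A decreasing coordinate has not yet passed its floor at the first meeting
        time; the other coordinates do not decrease.\<close>
      then have "target i - ?x i \<le> t * ?d i"
        using True by (simp add: neg_le_divide_eq)
      moreover have "0 \<le> target i"
        using True x by (simp add: target_def orthant_iff)
      ultimately show ?thesis
        by simp
    next
      case False
      then show ?thesis
        using t(1) x by (simp add: orthant_iff)
    qed
    moreover have "?d i = 0" if "n \<le> i" for i
      using that d frac_coords_subset[OF x] by (force simp: in_keys_iff subset_iff)
    ultimately show ?thesis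
      using x by (simp add: orthant_iff lookup_add)
  qed
  ultimately show ?thesis
    using t(1) by blast
qed

text \<open>The loss caused by one choice of \<open>k\<close> inequalities. Strong induction on the
  number of fractional coordinates; \<open>D\<close> and \<open>f\<close> stay fixed while the point
  moves inside their continuous relaxation.\<close>

lemma scaled_relaxation_in_integer_hull:
  fixes D :: "nat \<Rightarrow> rvec" and f :: "nat \<Rightarrow> real" and k n :: nat
  defines "K \<equiv> convex hull {x \<in> orthant n \<inter> lattice_points n. \<forall>j<k. dot n (D j) x \<le> f j}"
  assumes D: "\<And>j. j < k \<Longrightarrow> D j \<in> orthant n"
    and f: "\<And>j. j < k \<Longrightarrow> 0 \<le> f j"
    and unit: "\<And>i j. i < n \<Longrightarrow> j < k \<Longrightarrow> dot n (D j) (Poly_Mapping.single i 1) \<le> f j"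
    and x: "x \<in> orthant n" "\<And>j. j < k \<Longrightarrow> dot n (D j) x \<le> f j"
  shows "(1 / (real k + 1)) *\<^sub>R x \<in> K"
  using x
proof (induction "card (frac_coords x)" arbitrary: x rule: less_induct)
  case less
  let ?F = "frac_coords x"
  have convK: "convex K"
    by (simp add: K_def)
  have memK: "y \<in> K" if "y \<in> orthant n" "y \<in> lattice_points n" "\<And>j. j < k \<Longrightarrow> dot n (D j) y \<le> f j" for y
    unfolding K_def using that by (intro hull_inc) auto
  have FN: "?F \<subseteq> {..<n}"
    by (rule frac_coords_subset[OF less.prems(1)])
  show ?case
  proof (cases "k < card ?F")
    case True
    \<comment> \<open>More fractional coordinates than constraints: some direction supported on them
      leaves all \<open>k\<close> left-hand sides unchanged.\<close>
    obtain g where g: "\<exists>i\<in>?F. g i \<noteq> 0"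
      "\<forall>j<k. (\<Sum>i\<in>?F. Poly_Mapping.lookup (D j) i * g i) = 0"
      using ex_kernel_vector[OF finite_frac_coords True, of "\<lambda>j. Poly_Mapping.lookup (D j)"] by blast
    define d where "d = vec_on ?F g"
    have d: "Poly_Mapping.lookup d i = (if i \<in> ?F then g i else 0)" for i
      by (simp add: d_def lookup_vec_on finite_frac_coords)
    have d0: "d \<noteq> 0"
      using g(1) d by (metis lookup_zero)
    have dk: "Poly_Mapping.keys d \<subseteq> ?F" "Poly_Mapping.keys (- d) \<subseteq> ?F"
      using d by (auto simp: in_keys_iff split: if_splits)
    have dot_d: "dot n (D j) d = 0" if "j < k" for j
      using g(2) that by (simp add: d_def dot_vec_on_right FN)
    obtain s where s: "0 < s" "x + s *\<^sub>R d \<in> orthant n" "frac_coords (x + s *\<^sub>R d) \<subset> ?F"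
      using ex_move_to_integer_coordinate[OF less.prems(1) d0 dk(1)] by blast
    obtain t where t: "0 < t" "x + t *\<^sub>R (- d) \<in> orthant n" "frac_coords (x + t *\<^sub>R (- d)) \<subset> ?F"
      using ex_move_to_integer_coordinate[OF less.prems(1) _ dk(2)] d0 by auto
    have y: "(1 / (real k + 1)) *\<^sub>R (x + s *\<^sub>R d) \<in> K"
      using s less.prems(2) dot_d
      by (intro less.hyps psubset_card_mono finite_frac_coords) (auto simp: dot_add dot_scaleR)
    have "dot n (D j) (x + t *\<^sub>R (- d)) = dot n (D j) x" if "j < k" for j
      using dot_d[OF that] dot_scaleR[of n "D j" "-t" d] dot_add[of n "D j" x "(- t) *\<^sub>R d"] by simp
    then have z: "(1 / (real k + 1)) *\<^sub>R (x + t *\<^sub>R (- d)) \<in> K"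
      using t less.prems(2)
      by (intro less.hyps psubset_card_mono finite_frac_coords) auto
    \<comment> \<open>The two end points lie on opposite sides of \<open>x\<close>; with these
      weights the displacements along \<open>d\<close> and \<open>- d\<close> cancel.\<close>
    have "(t / (s + t)) *\<^sub>R (1 / (real k + 1)) *\<^sub>R (x + s *\<^sub>R d) +
        (s / (s + t)) *\<^sub>R (1 / (real k + 1)) *\<^sub>R (x + t *\<^sub>R (- d)) \<in> K"
      using s(1) t(1) by (intro convexD[OF convK y z]) (auto simp: add.commute simp flip: add_divide_distrib)
    also have "(t / (s + t)) *\<^sub>R (1 / (real k + 1)) *\<^sub>R (x + s *\<^sub>R d) +
        (s / (s + t)) *\<^sub>R (1 / (real k + 1)) *\<^sub>R (x + t *\<^sub>R (- d)) = (1 / (real k + 1)) *\<^sub>R x"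
    proof (rule poly_mapping_eqI)
      have "t / (s + t) * (1 / (real k + 1) * (u + s * v)) + s / (s + t) * (1 / (real k + 1) * (u - t * v))
          = (t + s) / (s + t) * (1 / (real k + 1) * u)" for u v
        by (simp only: divide_inverse ring_distribs mult_ac)
      moreover have "(t + s) / (s + t) = 1"
        using s(1) t(1) by simp
      ultimately show "Poly_Mapping.lookup ((t / (s + t)) *\<^sub>R (1 / (real k + 1)) *\<^sub>R (x + s *\<^sub>R d) +
          (s / (s + t)) *\<^sub>R (1 / (real k + 1)) *\<^sub>R (x + t *\<^sub>R (- d))) i =
          Poly_Mapping.lookup ((1 / (real k + 1)) *\<^sub>R x) i" for i
        by (simp add: lookup_add lookup_minus)
    qed
    finally show ?thesis .
  next
    case False
    define fl where "fl = vec_on {..<n} (\<lambda>i. real_of_int \<lfloor>Poly_Mapping.lookup x i\<rfloor>)"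
    have lookup_fl: "Poly_Mapping.lookup fl i = real_of_int \<lfloor>Poly_Mapping.lookup x i\<rfloor>" for i
      using less.prems(1) by (simp add: fl_def lookup_vec_on orthant_iff)
    \<comment> \<open>Rounding down keeps every constraint, since the coefficients are
      nonnegative.\<close>
    have "fl \<in> K"
    proof (rule memK)
      show "fl \<in> orthant n" "fl \<in> lattice_points n"
        using less.prems(1) by (auto simp: orthant_iff lattice_points_iff lookup_fl)
      fix j assume j: "j < k"
      have "dot n (D j) fl \<le> dot n (D j) x"
        unfolding dot_def
        using D[OF j] by (intro sum_mono mult_left_mono) (auto simp: lookup_fl orthant_iff)
      then show "dot n (D j) fl \<le> f j"
        using less.prems(2)[OF j] by simp
    qed
    have zero: "0 \<in> K"
      using f by (intro memK zero_orthant zero_lattice_points) auto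
    have units: "Poly_Mapping.single i 1 \<in> K" if "i < n" for i
      using unit that by (intro memK unit_orthant unit_lattice_points) auto
    have nF: "n \<notin> ?F"
      using FN by auto
    \<comment> \<open>\<open>n\<close> is a spare index, used for the floor of \<open>x\<close>.\<close>
    define y :: "nat \<Rightarrow> rvec" where "y = (\<lambda>i. if i = n then fl else Poly_Mapping.single i 1)"
    define a where "a = (\<lambda>i. (if i = n then 1 else frac (Poly_Mapping.lookup x i)) / (real k + 1))"
    \<comment> \<open>At most \<open>k\<close> fractional parts, each below 1. Together with the
      weight 1 of the floor they total at most \<open>k + 1\<close>, which is the scaling
      factor.\<close>
    have sum_F: "(\<Sum>i\<in>?F. frac (Poly_Mapping.lookup x i)) \<le> real k"
    proof -
      have "(\<Sum>i\<in>?F. frac (Poly_Mapping.lookup x i)) \<le> real (card ?F) * 1"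
        by (intro sum_bounded_above) (simp add: frac_lt_1 less_imp_le)
      then show ?thesis
        using False by simp
    qed
    have "sum a (insert n ?F) = (1 + (\<Sum>i\<in>?F. frac (Poly_Mapping.lookup x i))) / (real k + 1)"
    proof -
      have "sum a ?F = (\<Sum>i\<in>?F. frac (Poly_Mapping.lookup x i) / (real k + 1))"
        using nF by (intro sum.cong) (auto simp: a_def)
      then show ?thesis
        using nF finite_frac_coords by (simp add: a_def add_divide_distrib sum_divide_distrib)
    qed
    also have "\<dots> \<le> 1"
      using sum_F by simp
    finally have "(\<Sum>i\<in>insert n ?F. a i *\<^sub>R y i) \<in> K"
      using units \<open>fl \<in> K\<close> zero FN convK
      by (intro convex_subunit_sum) (auto simp: finite_frac_coords a_def y_def)
    also have "(\<Sum>i\<in>insert n ?F. a i *\<^sub>R y i) = (1 / (real k + 1)) *\<^sub>R x"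
    proof (rule poly_mapping_eqI)
      fix l
      let ?xl = "Poly_Mapping.lookup x l"
      have "(\<Sum>i\<in>?F. a i * Poly_Mapping.lookup (y i) l) =
          (\<Sum>i\<in>?F. if i = l then frac ?xl / (real k + 1) else 0)"
        using nF by (intro sum.cong) (auto simp: a_def y_def lookup_single when_def)
      \<comment> \<open>If \<open>l\<close> is not in \<open>?F\<close>, the sum is empty of
        contributions and \<open>frac ?xl\<close> is 0 as well.\<close>
      also have "\<dots> = frac ?xl / (real k + 1)"
        using finite_frac_coords[of x] by (auto simp: sum.delta frac_coords_def frac_eq_0_iff)
      finally have "Poly_Mapping.lookup (\<Sum>i\<in>insert n ?F. a i *\<^sub>R y i) l =
          (real_of_int \<lfloor>?xl\<rfloor> + frac ?xl) / (real k + 1)"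
        using nF finite_frac_coords
        by (simp add: lookup_sum lookup_add a_def y_def lookup_fl add_divide_distrib)
      then show "Poly_Mapping.lookup (\<Sum>i\<in>insert n ?F. a i *\<^sub>R y i) l =
          Poly_Mapping.lookup ((1 / (real k + 1)) *\<^sub>R x) l"
        by (simp add: frac_def)
    qed
    finally show ?thesis .
  qed
qed

section \<open>The aggregation closure\<close>

lemma convex_aggregation_closure: "convex (aggregation_closure n k Q)"
  unfolding aggregation_closure_def by (intro convex_Inter) auto

text \<open>The trivial inequality \<open>0 \<le> 0\<close>, repeated \<open>k\<close> times, is one
  of the choices, and its hull already lies in the orthant.\<close>

lemma aggregation_closure_subset_orthant: "aggregation_closure n k Q \<subseteq> orthant n"
proof -
  let ?K = "convex hull {x \<in> orthant n \<inter> lattice_points n. \<forall>j<k. dot n 0 x \<le> 0}"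
  have "aggregation_closure n k Q \<subseteq> ?K"
    unfolding aggregation_closure_def
    by (rule Inter_lower) (force simp: dot_def zero_orthant intro!: exI[of _ "\<lambda>_. 0"])
  also have "?K \<subseteq> orthant n"
    by (rule hull_minimal) (auto simp: convex_orthant)
  finally show ?thesis .
qed

lemma lattice_points_subset_aggregation_closure:
  assumes "Q \<subseteq> orthant n"
  shows "Q \<inter> lattice_points n \<subseteq> aggregation_closure n k Q"
  unfolding aggregation_closure_def using assms by (auto intro!: hull_inc)

text \<open>The rounding lemma applies to every choice of valid inequalities at once: validity at
  the origin gives \<open>0 \<le> f j\<close>, and validity at the unit vectors gives their
  feasibility.\<close>

lemma scaled_in_aggregation_closure:
  assumes Q: "Q \<subseteq> orthant n" "0 \<in> Q" "\<And>j. j < n \<Longrightarrow> Poly_Mapping.single j 1 \<in> Q"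
    and x: "x \<in> Q"
  shows "(1 / (real k + 1)) *\<^sub>R x \<in> aggregation_closure n k Q"
  unfolding aggregation_closure_def
proof (clarify, rule scaled_relaxation_in_integer_hull)
  fix D :: "nat \<Rightarrow> rvec" and f :: "nat \<Rightarrow> real" and j
  assume Df: "\<forall>j<k. D j \<in> orthant n \<and> (\<forall>x\<in>Q. dot n (D j) x \<le> f j)" and j: "j < k"
  show "D j \<in> orthant n" "dot n (D j) x \<le> f j"
    using Df j x by auto
  have "dot n (D j) 0 \<le> f j"
    using Df j Q(2) by blast
  then show "0 \<le> f j"
    by simp
  show "dot n (D j) (Poly_Mapping.single i 1) \<le> f j" if "i < n" for i
    using Df j Q(3) that by blast
qed (use x Q(1) in auto)

lemma aggregation_closure_funpow_subset_orthant:
  "Q \<subseteq> orthant n \<Longrightarrow> (aggregation_closure n k ^^ t) Q \<subseteq> orthant n"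
  by (cases t) (auto simp: aggregation_closure_subset_orthant[THEN subsetD])

lemma lattice_points_subset_aggregation_closure_funpow:
  assumes "Q \<subseteq> orthant n"
  shows "Q \<inter> lattice_points n \<subseteq> (aggregation_closure n k ^^ t) Q"
proof (induction t)
  case (Suc t)
  then show ?case
    using lattice_points_subset_aggregation_closure[OF
        aggregation_closure_funpow_subset_orthant[OF assms, where t = t and k = k], where k = k] by auto
qed simp

lemma integer_hull_subset_aggregation_closure_funpow:
  assumes "Q \<subseteq> orthant n" "convex Q"
  shows "integer_hull n Q \<subseteq> (aggregation_closure n k ^^ t) Q"
  unfolding integer_hull_def
proof (rule hull_minimal)
  show "Q \<inter> lattice_points n \<subseteq> (aggregation_closure n k ^^ t) Q"
    by (rule lattice_points_subset_aggregation_closure_funpow[OF assms(1)])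
  \<comment> \<open>For \<open>t = 0\<close> this is the convexity of \<open>Q\<close>; later
    iterates are intersections of convex hulls.\<close>
  show "convex ((aggregation_closure n k ^^ t) Q)"
    using assms(2) by (cases t) (auto simp: convex_aggregation_closure)
qed

text \<open>The one-round bound can be iterated because the origin and the unit vectors are lattice
  points of \<open>Q\<close>, hence survive in every iterate.\<close>

lemma scaled_in_aggregation_closure_funpow:
  assumes Q: "Q \<subseteq> orthant n" "0 \<in> Q" "\<And>j. j < n \<Longrightarrow> Poly_Mapping.single j 1 \<in> Q"
    and x: "x \<in> Q"
  shows "(1 / (real k + 1) ^ t) *\<^sub>R x \<in> (aggregation_closure n k ^^ t) Q"
proof (induction t)
  case 0
  then show ?case
    using x by simp
next
  case (Suc t)
  let ?R = "(aggregation_closure n k ^^ t) Q"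
  note sub = lattice_points_subset_aggregation_closure_funpow[OF Q(1), where k = k and t = t]
  have "(1 / (real k + 1)) *\<^sub>R (1 / (real k + 1) ^ t) *\<^sub>R x \<in> aggregation_closure n k ?R"
  proof (rule scaled_in_aggregation_closure)
    show "?R \<subseteq> orthant n"
      by (rule aggregation_closure_funpow_subset_orthant[OF Q(1)])
    show "0 \<in> ?R"
      using sub Q(2) zero_lattice_points by blast
    show "Poly_Mapping.single j 1 \<in> ?R" if "j < n" for j
      using sub Q(3) unit_lattice_points that by blast
  qed (rule Suc.IH)
  then show ?case
    by simp
qed

section \<open>The lower bound on the rank\<close>

lemma convex_packing_polyhedron: "convex (packing_polyhedron n m A b)"
proof -
  have "packing_polyhedron n m A b = orthant n \<inter> (\<Inter>i\<in>{..<m}. {x. dot n (vec_on {..<n} (A i)) x \<le> b i})"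
    by (auto simp: packing_polyhedron_def dot_vec_on_left)
  then show ?thesis
    by (auto intro!: convex_Int convex_INT convex_orthant convex_dot_le)
qed

lemma packing_polyhedron_subset_orthant: "packing_polyhedron n m A b \<subseteq> orthant n"
  by (auto simp: packing_polyhedron_def)

lemma zero_packing_polyhedron: "packing_data n m A b \<Longrightarrow> 0 \<in> packing_polyhedron n m A b"
  by (simp add: packing_polyhedron_def packing_data_def zero_orthant)

text \<open>This is where the hypothesis \<open>A i j \<le> b i\<close> enters the lower
  bound.\<close>

lemma unit_packing_polyhedron:
  assumes "\<forall>i<m. \<forall>j<n. A i j \<le> b i" "j < n"
  shows "Poly_Mapping.single j 1 \<in> packing_polyhedron n m A b"
  using assms
  by (auto simp: packing_polyhedron_def unit_orthant lookup_single when_def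
      if_distrib[of "\<lambda>z. _ * z"] sum.delta cong: if_cong)

lemma admissible_unit_integer_hull:
  assumes "admissible_instance n m A b c" "j < n"
  shows "Poly_Mapping.single j 1 \<in> integer_hull n (packing_polyhedron n m A b)"
  unfolding integer_hull_def
  using assms by (intro hull_inc) (auto simp: admissible_instance_def unit_packing_polyhedron unit_lattice_points)

lemma integer_hull_subset: "convex Q \<Longrightarrow> integer_hull n Q \<subseteq> Q"
  unfolding integer_hull_def by (rule hull_minimal) auto

lemma bdd_above_integer_hull:
  assumes "admissible_instance n m A b c"
  shows "bdd_above (dot n c ` integer_hull n (packing_polyhedron n m A b))"
proof (rule bdd_above_mono)
  show "bdd_above (dot n c ` packing_polyhedron n m A b)"
    using assms by (simp add: admissible_instance_def)
qed (intro image_mono integer_hull_subset convex_packing_polyhedron)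

text \<open>Some coordinate of \<open>c\<close> is positive, and the corresponding unit vector lies
  in the integer hull. Hence the integrality ratio has a positive denominator.\<close>

lemma opt_value_integer_hull_pos:
  assumes "admissible_instance n m A b c"
  shows "0 < opt_value n c (integer_hull n (packing_polyhedron n m A b))"
proof -
  have c: "c \<in> orthant n" "c \<noteq> 0"
    using assms by (auto simp: admissible_instance_def)
  obtain j where j: "Poly_Mapping.lookup c j \<noteq> 0"
    using c(2) by (metis lookup_zero poly_mapping_eqI)
  then have jn: "j < n"
    using c(1) unfolding orthant_iff by (meson linorder_not_less)
  have "0 < dot n c (Poly_Mapping.single j 1)"
    using c(1) j by (auto simp: dot_single[OF jn] orthant_iff less_le)
  also have "\<dots> \<le> opt_value n c (integer_hull n (packing_polyhedron n m A b))"
    unfolding opt_value_def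
    by (intro cSUP_upper admissible_unit_integer_hull[OF assms jn] bdd_above_integer_hull[OF assms])
  finally show ?thesis .
qed

lemma integrality_ratio_ge_1:
  assumes "admissible_instance n m A b c"
  shows "1 \<le> integrality_ratio n c (packing_polyhedron n m A b)"
proof -
  have "opt_value n c (integer_hull n (packing_polyhedron n m A b))
      \<le> opt_value n c (packing_polyhedron n m A b)"
    unfolding opt_value_def
  proof (rule cSUP_subset_mono)
    have "0 \<in> integer_hull n (packing_polyhedron n m A b)"
      unfolding integer_hull_def using assms
      by (intro hull_inc) (auto simp: admissible_instance_def zero_packing_polyhedron zero_lattice_points)
    then show "integer_hull n (packing_polyhedron n m A b) \<noteq> {}"
      by auto
  qed (use assms integer_hull_subset[OF convex_packing_polyhedron] in \<open>auto simp: admissible_instance_def\<close>)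
  then show ?thesis
    using opt_value_integer_hull_pos[OF assms] by (simp add: integrality_ratio_def)
qed

text \<open>If \<open>t\<close> rounds reach the integer hull, every feasible point divided by
  \<open>(k + 1) ^ t\<close> lies in it, so its objective value is at most that power times the
  integer optimum.\<close>

lemma integrality_ratio_le_power:
  assumes adm: "admissible_instance n m A b c"
    and eq: "(aggregation_closure n k ^^ t) (packing_polyhedron n m A b) =
      integer_hull n (packing_polyhedron n m A b)"
  shows "integrality_ratio n c (packing_polyhedron n m A b) \<le> (real k + 1) ^ t"
proof -
  let ?Q = "packing_polyhedron n m A b"
  let ?z = "opt_value n c (integer_hull n ?Q)"
  have data: "packing_data n m A b" "\<forall>i<m. \<forall>j<n. A i j \<le> b i"
    using adm by (auto simp: admissible_instance_def)
  have "dot n c x \<le> (real k + 1) ^ t * ?z" if "x \<in> ?Q" for x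
  proof -
    have "(1 / (real k + 1) ^ t) *\<^sub>R x \<in> integer_hull n ?Q"
      unfolding eq[symmetric]
      by (intro scaled_in_aggregation_closure_funpow packing_polyhedron_subset_orthant
          zero_packing_polyhedron unit_packing_polyhedron data that)
    then have "dot n c ((1 / (real k + 1) ^ t) *\<^sub>R x) \<le> ?z"
      unfolding opt_value_def by (intro cSUP_upper bdd_above_integer_hull[OF adm])
    then show ?thesis
      by (simp add: dot_scaleR field_simps)
  qed
  then have "opt_value n c ?Q \<le> (real k + 1) ^ t * ?z"
    unfolding opt_value_def[of n c ?Q]
    using zero_packing_polyhedron[OF data(1)] by (intro cSUP_least) auto
  then show ?thesis
    using opt_value_integer_hull_pos[OF adm] by (simp add: integrality_ratio_def field_simps)
qed

text \<open>A finite infimum comes from a nonempty set of naturals and is therefore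
  attained.\<close>

lemma aggregation_rank_eq_enatD:
  assumes "aggregation_rank n k Q = enat t"
  shows "(aggregation_closure n k ^^ t) Q = integer_hull n Q"
proof -
  let ?S = "{enat t | t. (aggregation_closure n k ^^ t) Q = integer_hull n Q}"
  have "Inf ?S \<noteq> \<infinity>"
    using assms by (simp add: aggregation_rank_def)
  then have "?S \<noteq> {}"
    unfolding Inf_enat_def by meson
  then have "Inf ?S \<in> ?S"
    unfolding Inf_enat_def by (metis (no_types, lifting) LeastI_ex ex_in_conv)
  then show ?thesis
    using assms by (auto simp: aggregation_rank_def)
qed

lemma aggregation_rank_ge:
  assumes adm: "admissible_instance n m A b c" and k: "1 \<le> k"
  shows "ereal (of_int \<lceil>log 2 (integrality_ratio n c (packing_polyhedron n m A b)) / log 2 (real k + 1)\<rceil>)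
    \<le> ereal_of_enat (aggregation_rank n k (packing_polyhedron n m A b))"
proof (cases "aggregation_rank n k (packing_polyhedron n m A b)")
  case (enat t)
  let ?r = "integrality_ratio n c (packing_polyhedron n m A b)"
  have "?r \<le> (real k + 1) ^ t"
    using adm aggregation_rank_eq_enatD[OF enat] by (rule integrality_ratio_le_power)
  then have "log 2 ?r \<le> log 2 ((real k + 1) ^ t)"
    using integrality_ratio_ge_1[OF adm] by simp
  also have "\<dots> = real t * log 2 (real k + 1)"
    by (simp add: log_nat_power)
  finally have "log 2 ?r / log 2 (real k + 1) \<le> real t"
    using k by (simp add: divide_le_eq zero_less_log_cancel_iff)
  \<comment> \<open>The rank is an integer, so the bound passes to the ceiling.\<close>
  then have "\<lceil>log 2 ?r / log 2 (real k + 1)\<rceil> \<le> int t"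
    by (simp add: ceiling_le_iff)
  then have "real_of_int \<lceil>log 2 ?r / log 2 (real k + 1)\<rceil> \<le> real t"
    by linarith
  then show ?thesis
    by (simp add: enat)
qed simp

section \<open>Edge relaxations of complete graphs\<close>

text \<open>The row \<open>p * n + q\<close> is the edge inequality \<open>x p + x q \<le> 1\<close>, and \<open>x p \<le> 1\<close> if \<open>p = q\<close>.\<close>

definition edge_matrix :: "nat \<Rightarrow> nat \<Rightarrow> nat \<Rightarrow> real" where
  "edge_matrix n i j = (if j = i div n \<or> j = i mod n then 1 else 0)"

abbreviation edge_relaxation :: "nat \<Rightarrow> rvec set" where
  "edge_relaxation n \<equiv> packing_polyhedron n (n * n) (edge_matrix n) (\<lambda>_. 1)"

abbreviation all_ones :: "nat \<Rightarrow> rvec" where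
  "all_ones n \<equiv> vec_on {..<n} (\<lambda>_. 1)"

text \<open>The clique inequalities of the complete graph for all cliques of at most
  \<open>s\<close> nodes. They interpolate between the edge relaxation (\<open>s = 2\<close>) and
  the integer hull (\<open>s = n\<close>).\<close>

definition clique_relaxation :: "nat \<Rightarrow> nat \<Rightarrow> rvec set" where
  "clique_relaxation n s =
    {x \<in> orthant n. \<forall>T\<subseteq>{..<n}. card T \<le> s \<longrightarrow> (\<Sum>j\<in>T. Poly_Mapping.lookup x j) \<le> 1}"

lemma div_mod_less_of_less_square:
  fixes i n :: nat
  assumes "i < n * n"
  shows "i div n < n" "i mod n < n"
proof -
  have "0 < n"
    using assms by (cases n) auto
  then show "i div n < n" "i mod n < n"
    using assms by (auto simp: less_mult_imp_div_less)
qed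

lemma edge_matrix_row_sum:
  assumes "i < n * n"
  shows "(\<Sum>j<n. edge_matrix n i j * y j) = sum y {i div n, i mod n}"
proof -
  have "i div n < n" "i mod n < n"
    using assms by (rule div_mod_less_of_less_square)+
  then show ?thesis
    by (intro sum.mono_neutral_cong_right) (auto simp: edge_matrix_def)
qed

text \<open>Every nonempty set of at most two nodes is \<open>{i div n, i mod n}\<close> for some
  row \<open>i\<close>; the diagonal rows give the singletons.\<close>

lemma edge_relaxation_eq_clique_relaxation: "edge_relaxation n = clique_relaxation n 2"
proof (intro equalityI subsetI)
  fix x assume x: "x \<in> edge_relaxation n"
  have pair: "(\<Sum>j\<in>{p, q}. Poly_Mapping.lookup x j) \<le> 1" if "p < n" "q < n" for p q
  proof -
    have "p * n + q < n * n"
    proof -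
      have "p * n + q < Suc p * n"
        using that by simp
      also have "\<dots> \<le> n * n"
        using that by (intro mult_right_mono) auto
      finally show ?thesis .
    qed
    then have "(\<Sum>j<n. edge_matrix n (p * n + q) j * Poly_Mapping.lookup x j) \<le> 1"
      using x by (simp add: packing_polyhedron_def)
    then show ?thesis
      using edge_matrix_row_sum[OF \<open>p * n + q < n * n\<close>] that by simp
  qed
  have "(\<Sum>j\<in>T. Poly_Mapping.lookup x j) \<le> 1" if T: "T \<subseteq> {..<n}" "card T \<le> 2" for T
  proof (cases "T = {}")
    case False
    have "finite T"
      using T finite_subset by blast
    then consider "card T = 1" | "card T = 2"
      using T(2) False by (metis One_nat_def card_0_eq le_neq_implies_less less_2_cases)
    then obtain p q where "T = {p, q}"
      by (metis card_1_singletonE card_2_iff insert_absorb2)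
    then show ?thesis
      using pair T by simp
  qed simp
  then show "x \<in> clique_relaxation n 2"
    using x by (auto simp: clique_relaxation_def packing_polyhedron_def)
next
  fix x assume x: "x \<in> clique_relaxation n 2"
  have "sum (Poly_Mapping.lookup x) {i div n, i mod n} \<le> 1" if "i < n * n" for i
  proof -
    have "{i div n, i mod n} \<subseteq> {..<n}"
      using that div_mod_less_of_less_square by auto
    moreover have "card {i div n, i mod n} \<le> 2"
      by (simp add: card_insert_if)
    ultimately show ?thesis
      using x unfolding clique_relaxation_def by blast
  qed
  then show "x \<in> edge_relaxation n"
    using x by (auto simp: packing_polyhedron_def edge_matrix_row_sum clique_relaxation_def)
qed

section \<open>One round almost doubles the size of the valid cliques\<close>

lemma sum_less_2_of_half_subsets:
  fixes y :: "'a \<Rightarrow> real"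
  assumes T: "finite T" "card T \<le> Suc (2 * s)"
    and half: "\<And>S. S \<subseteq> T \<Longrightarrow> card S \<le> Suc s \<Longrightarrow> sum y S \<le> 1"
  shows "sum y T \<le> 2 * real (card T) / (real (card T) + 1)"
proof -
  have "sum y T \<le> 2 - y p" if p: "p \<in> T" for p
  proof -
    have "(card T - 1) div 2 \<le> card (T - {p})"
      using p T by simp
    \<comment> \<open>The nodes other than \<open>p\<close> are split into halves \<open>U\<close>
      and \<open>V\<close>, of at most \<open>s\<close> nodes each because
      \<open>card T - 1 \<le> 2 * s\<close>; adding \<open>p\<close> to both gives two cliques of
      allowed size.\<close>
    then obtain U where U: "U \<subseteq> T - {p}" "card U = (card T - 1) div 2" "finite U"
      by (rule obtain_subset_with_card_n)
    define V where "V = T - {p} - U"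
    have V: "card V = (card T - 1) - (card T - 1) div 2" "finite V" "p \<notin> V"
      using U p T by (auto simp: V_def card_Diff_subset)
    have "card (insert p U) \<le> Suc s" "card (insert p V) \<le> Suc s"
      using U V T by (auto simp: card_insert_if)
    then have "sum y (insert p U) \<le> 1" "sum y (insert p V) \<le> 1"
      using U p by (auto intro!: half simp del: sum.insert simp: V_def)
    moreover have "sum y (insert p U) = y p + sum y U" "sum y (insert p V) = y p + sum y V"
      using U V by (auto intro!: sum.insert)
    moreover have "sum y T = y p + sum y (T - {p})"
      using p T by (simp add: sum.remove)
    moreover have "sum y (T - {p}) = sum y V + sum y U"
      unfolding V_def using U(1) T by (intro sum.subset_diff) auto
    ultimately show ?thesis
      by linarith
  qed
  \<comment> \<open>Summing over \<open>p\<close> gives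
    \<open>card T * sum y T \<le> 2 * card T - sum y T\<close>.\<close>
  then have "(\<Sum>p\<in>T. sum y T) \<le> (\<Sum>p\<in>T. 2 - y p)"
    by (intro sum_mono)
  then show ?thesis
    by (simp add: sum_subtractf field_simps)
qed

text \<open>For each \<open>T\<close> a single aggregated inequality suffices:
  \<open>x(T) \<le> f\<close> is valid for \<open>Q\<close> with \<open>f < 2\<close>, and lattice
  points then satisfy \<open>x(T) \<le> 1\<close>.\<close>

lemma aggregation_closure_clique_relaxation:
  assumes Q: "Q \<subseteq> clique_relaxation n (Suc s)"
  shows "aggregation_closure n 1 Q \<subseteq> clique_relaxation n (Suc (2 * s))"
proof
  fix x assume x: "x \<in> aggregation_closure n 1 Q"
  have "(\<Sum>j\<in>T. Poly_Mapping.lookup x j) \<le> 1" if T: "T \<subseteq> {..<n}" "card T \<le> Suc (2 * s)" for T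
  proof -
    define u where "u = vec_on T (\<lambda>_. 1)"
    define f where "f = 2 * real (card T) / (real (card T) + 1)"
    have finT: "finite T"
      using T finite_subset by blast
    have dot_u: "dot n u z = (\<Sum>j\<in>T. Poly_Mapping.lookup z j)" for z
      using T by (simp add: u_def dot_vec_on_left)
    have u: "u \<in> orthant n"
      using T finT by (auto simp: u_def orthant_iff lookup_vec_on)
    have valid: "dot n u z \<le> f" if "z \<in> Q" for z
      unfolding dot_u f_def
    proof (rule sum_less_2_of_half_subsets[OF finT T(2)])
      fix S assume "S \<subseteq> T" "card S \<le> Suc s"
      moreover have "z \<in> clique_relaxation n (Suc s)"
        using Q that by blast
      ultimately show "(\<Sum>j\<in>S. Poly_Mapping.lookup z j) \<le> 1"
        using T unfolding clique_relaxation_def by blast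
    qed
    have "f < 2"
      by (simp add: f_def divide_less_eq)
    let ?S = "{x \<in> orthant n \<inter> lattice_points n. \<forall>j<(1::nat). dot n u x \<le> f}"
    have "x \<in> convex hull ?S"
      using x u valid unfolding aggregation_closure_def
      by (intro InterD[OF x[unfolded aggregation_closure_def]] CollectI
          exI[of _ "\<lambda>_. u"] exI[of _ "\<lambda>_. f"]) auto
    also have "convex hull ?S \<subseteq> {x. dot n u x \<le> 1}"
    proof (intro hull_minimal convex_dot_le subsetI CollectI)
      fix z assume z: "z \<in> ?S"
      have "dot n u z \<in> \<int>"
        unfolding dot_u using z by (intro Ints_sum) (auto simp: lattice_points_iff)
      then obtain i where i: "dot n u z = of_int i"
        by (auto elim: Ints_cases)
      have "dot n u z < 2"
        using z \<open>f < 2\<close> by auto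
      then show "dot n u z \<le> 1"
        by (simp add: i)
    qed
    finally show ?thesis
      by (simp add: dot_u)
  qed
  then show "x \<in> clique_relaxation n (Suc (2 * s))"
    using x aggregation_closure_subset_orthant[of n 1 Q] by (auto simp: clique_relaxation_def)
qed

text \<open>At \<open>t = 0\<close> the clique size is 2, that of the edge relaxation; each round
  takes \<open>Suc s\<close> to \<open>Suc (2 * s)\<close>, here with
  \<open>s = 2 ^ t\<close>.\<close>

lemma aggregation_closure_funpow_edge_relaxation:
  "(aggregation_closure n 1 ^^ t) (edge_relaxation n) \<subseteq> clique_relaxation n (Suc (2 ^ t))"
proof (induction t)
  case 0
  then show ?case
    by (simp add: edge_relaxation_eq_clique_relaxation numeral_2_eq_2)
next
  case (Suc t)
  then show ?case
    using aggregation_closure_clique_relaxation by simp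
qed

section \<open>Rank and integrality ratio of the edge relaxation\<close>

lemma admissible_edge_relaxation:
  assumes "0 < n"
  shows "admissible_instance n (n * n) (edge_matrix n) (\<lambda>_. 1) (all_ones n)"
proof -
  have "Poly_Mapping.lookup (all_ones n) 0 = 1"
    using assms by (simp add: lookup_vec_on)
  then have "all_ones n \<noteq> 0"
    by auto
  moreover have "all_ones n \<in> orthant n"
    by (auto simp: orthant_iff lookup_vec_on)
  moreover have "dot n (all_ones n) x \<le> real n" if "x \<in> edge_relaxation n" for x
  proof -
    have "Poly_Mapping.lookup x j \<le> 1" if "j < n" for j
      using \<open>x \<in> edge_relaxation n\<close> that unfolding edge_relaxation_eq_clique_relaxation
      by (auto simp: clique_relaxation_def dest!: spec[of _ "{j}"])
    then have "(\<Sum>j<n. Poly_Mapping.lookup x j) \<le> real (card {..<n}) * 1"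
      by (intro sum_bounded_above) auto
    then show ?thesis
      by (simp add: dot_vec_on_left)
  qed
  then have "bdd_above (dot n (all_ones n) ` edge_relaxation n)"
    by (rule bdd_aboveI2)
  ultimately show ?thesis
    by (auto simp: admissible_instance_def packing_data_def edge_matrix_def)
qed

lemma all_ones_opt_value_clique_le:
  assumes "S \<subseteq> clique_relaxation n n" "S \<noteq> {}"
  shows "opt_value n (all_ones n) S \<le> 1"
  unfolding opt_value_def
  using assms by (intro cSUP_least) (auto simp: clique_relaxation_def dot_vec_on_left)

text \<open>A point of coordinate sum at most 1 is a subconvex combination of the unit vectors, with
  its own coordinates as weights.\<close>

lemma clique_relaxation_subset_integer_hull:
  assumes "0 < n"
  shows "clique_relaxation n n \<subseteq> integer_hull n (edge_relaxation n)"
proof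
  fix x assume x: "x \<in> clique_relaxation n n"
  let ?H = "integer_hull n (edge_relaxation n)"
  note adm = admissible_edge_relaxation[OF assms]
  have "(\<Sum>j<n. Poly_Mapping.lookup x j *\<^sub>R Poly_Mapping.single j (1::real)) \<in> ?H"
  proof (rule convex_subunit_sum)
    show "convex ?H"
      by (simp add: integer_hull_def)
    show "0 \<in> ?H"
      unfolding integer_hull_def using adm
      by (intro hull_inc) (auto simp: admissible_instance_def zero_packing_polyhedron zero_lattice_points)
  qed (use x in \<open>auto simp: clique_relaxation_def orthant_iff intro: admissible_unit_integer_hull[OF adm]\<close>)
  also have "(\<Sum>j<n. Poly_Mapping.lookup x j *\<^sub>R Poly_Mapping.single j (1::real)) = x"
    using x
    by (intro poly_mapping_eqI)
      (auto simp: lookup_sum lookup_single when_def clique_relaxation_def orthant_iff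
        if_distrib[of "\<lambda>z. _ * z"] sum.delta cong: if_cong)
  finally show "x \<in> ?H" .
qed

text \<open>The number of nodes is exactly the clique size that is valid after \<open>t\<close>
  rounds, so the inequality of the whole graph holds then.\<close>

lemma integer_hull_edge_relaxation_eq_funpow:
  assumes "n = Suc (2 ^ t)"
  shows "(aggregation_closure n 1 ^^ t) (edge_relaxation n) = integer_hull n (edge_relaxation n)"
proof
  show "(aggregation_closure n 1 ^^ t) (edge_relaxation n) \<subseteq> integer_hull n (edge_relaxation n)"
    using aggregation_closure_funpow_edge_relaxation[where n = n and t = t] clique_relaxation_subset_integer_hull[of n]
    unfolding assms[symmetric] using assms by auto
qed (intro integer_hull_subset_aggregation_closure_funpow packing_polyhedron_subset_orthant
    convex_packing_polyhedron)

lemma aggregation_rank_edge_relaxation_le: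
  assumes "n = Suc (2 ^ t)"
  shows "aggregation_rank n 1 (edge_relaxation n) \<le> enat t"
  unfolding aggregation_rank_def
  using integer_hull_edge_relaxation_eq_funpow[OF assms] by (intro Inf_lower) auto

lemma integrality_ratio_edge_relaxation_ge:
  assumes n: "n = Suc (2 ^ t)"
  shows "real n / 2 \<le> integrality_ratio n (all_ones n) (edge_relaxation n)"
proof -
  let ?Q = "edge_relaxation n"
  have adm: "admissible_instance n (n * n) (edge_matrix n) (\<lambda>_. 1) (all_ones n)"
    using n by (intro admissible_edge_relaxation) simp
  \<comment> \<open>The all-halves point satisfies every edge inequality and has value
    \<open>n / 2\<close>.\<close>
  define h where "h = vec_on {..<n} (\<lambda>_. 1 / 2)"
  have "h \<in> ?Q"
  proof -
    have "(\<Sum>j\<in>T. Poly_Mapping.lookup h j) \<le> 1" if "T \<subseteq> {..<n}" "card T \<le> 2" for T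
    proof -
      have "(\<Sum>j\<in>T. Poly_Mapping.lookup h j) \<le> real (card T) * (1 / 2)"
        by (intro sum_bounded_above) (simp add: h_def lookup_vec_on)
      then show ?thesis
        using that(2) by simp
    qed
    then show ?thesis
      unfolding edge_relaxation_eq_clique_relaxation clique_relaxation_def
      by (auto simp: orthant_iff h_def lookup_vec_on)
  qed
  then have "dot n (all_ones n) h \<le> opt_value n (all_ones n) ?Q"
    unfolding opt_value_def using adm by (intro cSUP_upper) (auto simp: admissible_instance_def)
  moreover have "dot n (all_ones n) h = real n / 2"
    by (simp add: dot_vec_on_left h_def lookup_vec_on)
  \<comment> \<open>The hull equals the \<open>t\<close>-th iterate, which satisfies the clique
    inequality of all \<open>n\<close> nodes.\<close>
  moreover have "opt_value n (all_ones n) (integer_hull n ?Q) \<le> 1"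
  proof (rule all_ones_opt_value_clique_le)
    show "integer_hull n ?Q \<subseteq> clique_relaxation n n"
      using aggregation_closure_funpow_edge_relaxation[where n = n and t = t]
      unfolding integer_hull_edge_relaxation_eq_funpow[OF n] n[symmetric] .
    show "integer_hull n ?Q \<noteq> {}"
      using admissible_unit_integer_hull[OF adm, of 0] n by auto
  qed
  moreover have "0 < opt_value n (all_ones n) (integer_hull n ?Q)"
    by (rule opt_value_integer_hull_pos[OF adm])
  ultimately show ?thesis
    unfolding integrality_ratio_def
    by (smt (verit, best) frac_le of_nat_0_le_iff div_by_1 divide_nonneg_nonneg)
qed

text \<open>The rank may be infinite, so the lower bound is stated in \<open>ereal\<close>.
  Tightness is stated for a sequence of instances with ratio tending to infinity, so that the
  O-bound compares growth rates.\<close>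

theorem theorem3:
  shows
    "(\<forall>(n::nat) (m::nat) (A::nat \<Rightarrow> nat \<Rightarrow> real) (b::nat \<Rightarrow> real) (c::rvec) (k::nat).
        admissible_instance n m A b c \<and> 1 \<le> k \<longrightarrow>
        ereal (of_int \<lceil>log 2 (integrality_ratio n c (packing_polyhedron n m A b)) / log 2 (real k + 1)\<rceil>)
          \<le> ereal_of_enat (aggregation_rank n k (packing_polyhedron n m A b)))
     \<and>
     (\<exists>(n::nat \<Rightarrow> nat) (m::nat \<Rightarrow> nat) (A::nat \<Rightarrow> nat \<Rightarrow> nat \<Rightarrow> real) (b::nat \<Rightarrow> nat \<Rightarrow> real)
        (c::nat \<Rightarrow> rvec) (r::nat \<Rightarrow> nat).
        (\<forall>t. admissible_instance (n t) (m t) (A t) (b t) (c t) \<and>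
             aggregation_rank (n t) 1 (packing_polyhedron (n t) (m t) (A t) (b t)) = enat (r t)) \<and>
        filterlim (\<lambda>t. integrality_ratio (n t) (c t) (packing_polyhedron (n t) (m t) (A t) (b t)))
          at_top sequentially \<and>
        (\<lambda>t. real (r t)) \<in>
          O(\<lambda>t. log 2 (integrality_ratio (n t) (c t) (packing_polyhedron (n t) (m t) (A t) (b t)))))"
proof (intro conjI allI impI)
  fix n m :: nat and A :: "nat \<Rightarrow> nat \<Rightarrow> real" and b :: "nat \<Rightarrow> real" and c :: rvec and k :: nat
  assume "admissible_instance n m A b c \<and> 1 \<le> k"
  then show "ereal (of_int \<lceil>log 2 (integrality_ratio n c (packing_polyhedron n m A b)) / log 2 (real k + 1)\<rceil>)
      \<le> ereal_of_enat (aggregation_rank n k (packing_polyhedron n m A b))"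
    using aggregation_rank_ge by blast
next
  define n :: "nat \<Rightarrow> nat" where "n = (\<lambda>t. Suc (2 ^ t))"
  \<comment> \<open>The rank is at most \<open>t\<close>, hence finite, so \<open>the_enat\<close>
    returns it.\<close>
  define r where "r = (\<lambda>t. the_enat (aggregation_rank (n t) 1 (edge_relaxation (n t))))"
  define \<rho> where "\<rho> = (\<lambda>t. integrality_ratio (n t) (all_ones (n t)) (edge_relaxation (n t)))"
  have adm: "admissible_instance (n t) (n t * n t) (edge_matrix (n t)) (\<lambda>_. 1) (all_ones (n t))" for t
    by (intro admissible_edge_relaxation) (simp add: n_def)
  have rank_le: "aggregation_rank (n t) 1 (edge_relaxation (n t)) \<le> enat t" for t
    by (rule aggregation_rank_edge_relaxation_le) (simp add: n_def)
  have rank: "aggregation_rank (n t) 1 (edge_relaxation (n t)) = enat (r t)" for t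
    using rank_le[of t] by (cases "aggregation_rank (n t) 1 (edge_relaxation (n t))") (auto simp: r_def)
  have r: "r t \<le> t" for t
    using rank_le[of t] rank[of t] by simp
  have \<rho>: "2 ^ t / 2 \<le> \<rho> t" for t
    using integrality_ratio_edge_relaxation_ge[of "n t" t] by (simp add: n_def \<rho>_def)
  have "filterlim \<rho> at_top sequentially"
  proof (rule filterlim_at_top_mono)
    show "filterlim (\<lambda>t. 2 ^ t / 2 :: real) at_top sequentially"
      by real_asymp
  qed (use \<rho> in auto)
  moreover have "(\<lambda>t. real (r t)) \<in> O(\<lambda>t. log 2 (\<rho> t))"
  proof (rule bigoI[of _ 2], rule eventually_sequentiallyI[of 2])
    \<comment> \<open>The rank is at most \<open>t\<close> and the logarithm at least
      \<open>t - 1\<close>; from \<open>t = 2\<close> on, \<open>t \<le> 2 * (t - 1)\<close>, which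
      gives the constant 2.\<close>
    fix t :: nat assume t: "2 \<le> t"
    have "real t - 1 = log 2 (2 ^ t / 2)"
      by (simp add: log_divide log_nat_power)
    also have "\<dots> \<le> log 2 (\<rho> t)"
      using \<rho>[of t] by (intro log_mono) auto
    finally have "real (r t) \<le> 2 * log 2 (\<rho> t)"
      using r[of t] t by linarith
    then show "norm (real (r t)) \<le> 2 * norm (log 2 (\<rho> t))"
      by simp
  qed
  ultimately show "\<exists>(n::nat \<Rightarrow> nat) (m::nat \<Rightarrow> nat) (A::nat \<Rightarrow> nat \<Rightarrow> nat \<Rightarrow> real) (b::nat \<Rightarrow> nat \<Rightarrow> real)
        (c::nat \<Rightarrow> rvec) (r::nat \<Rightarrow> nat).
        (\<forall>t. admissible_instance (n t) (m t) (A t) (b t) (c t) \<and>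
             aggregation_rank (n t) 1 (packing_polyhedron (n t) (m t) (A t) (b t)) = enat (r t)) \<and>
        filterlim (\<lambda>t. integrality_ratio (n t) (c t) (packing_polyhedron (n t) (m t) (A t) (b t)))
          at_top sequentially \<and>
        (\<lambda>t. real (r t)) \<in>
          O(\<lambda>t. log 2 (integrality_ratio (n t) (c t) (packing_polyhedron (n t) (m t) (A t) (b t))))"
    using adm rank unfolding \<rho>_def
    by (intro exI[of _ n] exI[of _ "\<lambda>t. n t * n t"] exI[of _ "\<lambda>t. edge_matrix (n t)"]
        exI[of _ "\<lambda>_ _. 1"] exI[of _ "\<lambda>t. all_ones (n t)"] exI[of _ r]) auto
qed

end
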